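(* Let $(G,p,k)$ be an instance of \textsc{Maximum Happy Vertices} with $p:S\to[\ell]$. Then $(G,p,k)$ is a yes-instance of \textsc{Maximum Happy Vertices} if and only if $(G^2[\mathcal{H}(G,p)],\{\mathcal{H}_1(G,p),\mathcal{H}_2(G,p),\dots,\mathcal{H}_\ell(G,p)\},|\mathcal{H}(G,p)|-k)$ is a yes-instance of \textsc{Group Multiway Cut}.
   Context: All graphs are finite, simple and undirected; $[\ell]=\{1,\dots,\ell\}$. Given a coloring $c:V(G)\to[\ell]$, a vertex $v$ is happy if $c(u)=c(v)$ for every neighbour $u$ of $v$. \textsc{Maximum Happy Vertices}: given a graph $G$, a partial coloring $p: S\to[\ell]$ for some $S\subseteq V(G)$, and an integer $k$, decide whether there is a coloring $c:V(G)\to[\ell]$ extending $p$ with at least $k$ happy vertices. A vertex $v$ is potentially happy if some coloring extending $p$ makes $v$ happy; $\mathcal{H}(G,p)$ is the set of potentially happy vertices, and for $i\in[\ell]$, $\mathcal{H}_i(G,p)=\{v\in\mathcal{H}(G,p)\mid N[v]\cap p^{-1}(i)\neq\emptyset\}$, where $N[v]$ is the closed neighbourhood. $G^2$ is the square of $G$ (same vertex set, $u\ne v$ adjacent iff their distance in $G$ is at most 2), and $G^2[X]$ its induced subgraph on $X$. \textsc{Group Multiway Cut}: given a graph $G$, pairwise disjoint terminal sets $T_1,\dots,T_\ell\subseteq V(G)$ and an integer $k$, decide whether there is $S\subseteq V(G)$ with $|S|\le k$ such that $G - S$ has no $u$–$v$ path for any $u\in T_i$, $v\in T_j$, $i\neq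 j$. *)

theory Defs
  imports "Graph_Theory.Graph_Theory" "HOL-Library.FuncSet" "HOL-Library.Disjoint_Sets"
begin

text \<open>
  A finite simple undirected graph is an instance of the locale \<open>graph\<close>: a finite symmetric
  digraph without loops and parallel arcs, in which an edge is a pair of opposite arcs.
\<close>

definition closed_nbhd :: "('a, 'b) pre_digraph \<Rightarrow> 'a \<Rightarrow> 'a set" where
  "closed_nbhd G v = insert v {u. v \<rightarrow>\<^bsub>G\<^esub> u}"

definition graph_dist :: "('a, 'b) pre_digraph \<Rightarrow> 'a \<Rightarrow> 'a \<Rightarrow> ereal" where
  "graph_dist G u v = wf_digraph.\<mu> G (\<lambda>_. 1) u v"

definition square :: "('a, 'b) pre_digraph \<Rightarrow> ('a, 'a \<times> 'a) pre_digraph" where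
  "square G = with_proj
     \<lparr> pverts = verts G,
       parcs = {(u, v). u \<in> verts G \<and> v \<in> verts G \<and> u \<noteq> v \<and> graph_dist G u v \<le> 2} \<rparr>"

definition delete_verts :: "('a, 'b) pre_digraph \<Rightarrow> 'a set \<Rightarrow> ('a, 'b) pre_digraph" where
  "delete_verts G S = G \<restriction> (verts G - S)"

text \<open>
  A partial coloring is a map \<open>p\<close> whose domain is the set of precolored vertices. A coloring is
  a total function constrained on \<^term>\<open>verts G\<close> only; its values elsewhere are irrelevant.
\<close>

definition partial_coloring :: "('a, 'b) pre_digraph \<Rightarrow> nat \<Rightarrow> ('a \<Rightarrow> nat option) \<Rightarrow> bool" where
  "partial_coloring G l p \<longleftrightarrow> dom p \<subseteq> verts G \<and> ran p \<subseteq> {1..l}"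

definition extending_colorings ::
    "('a, 'b) pre_digraph \<Rightarrow> nat \<Rightarrow> ('a \<Rightarrow> nat option) \<Rightarrow> ('a \<Rightarrow> nat) set" where
  "extending_colorings G l p = {c \<in> verts G \<rightarrow> {1..l}. \<forall>v\<in>dom p. p v = Some (c v)}"

definition happy :: "('a, 'b) pre_digraph \<Rightarrow> ('a \<Rightarrow> nat) \<Rightarrow> 'a \<Rightarrow> bool" where
  "happy G c v \<longleftrightarrow> (\<forall>u. v \<rightarrow>\<^bsub>G\<^esub> u \<longrightarrow> c u = c v)"

definition potentially_happy ::
    "('a, 'b) pre_digraph \<Rightarrow> nat \<Rightarrow> ('a \<Rightarrow> nat option) \<Rightarrow> 'a set" where
  "potentially_happy G l p = {v \<in> verts G. \<exists>c \<in> extending_colorings G l p. happy G c v}"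

definition potentially_happy_in ::
    "('a, 'b) pre_digraph \<Rightarrow> nat \<Rightarrow> ('a \<Rightarrow> nat option) \<Rightarrow> nat \<Rightarrow> 'a set" where
  "potentially_happy_in G l p i =
     {v \<in> potentially_happy G l p. closed_nbhd G v \<inter> {u. p u = Some i} \<noteq> {}}"

definition mhv_instance :: "('a, 'b) pre_digraph \<Rightarrow> nat \<Rightarrow> ('a \<Rightarrow> nat option) \<Rightarrow> bool" where
  "mhv_instance G l p \<longleftrightarrow> graph G \<and> partial_coloring G l p"

definition mhv_yes_instance ::
    "('a, 'b) pre_digraph \<Rightarrow> nat \<Rightarrow> ('a \<Rightarrow> nat option) \<Rightarrow> int \<Rightarrow> bool" where
  "mhv_yes_instance G l p k \<longleftrightarrow> mhv_instance G l p \<and>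
     (\<exists>c \<in> extending_colorings G l p. int (card {v \<in> verts G. happy G c v}) \<ge> k)"

text \<open>
  The terminal sets are \<open>T 1, \<dots>, T l\<close>. The budget \<open>k\<close> is an integer; a negative one makes a
  no-instance.
\<close>

definition gmc_instance :: "('a, 'b) pre_digraph \<Rightarrow> nat \<Rightarrow> (nat \<Rightarrow> 'a set) \<Rightarrow> bool" where
  "gmc_instance G l T \<longleftrightarrow>
     graph G \<and> (\<forall>i\<in>{1..l}. T i \<subseteq> verts G) \<and> disjoint_family_on T {1..l}"

definition gmc_yes_instance ::
    "('a, 'b) pre_digraph \<Rightarrow> nat \<Rightarrow> (nat \<Rightarrow> 'a set) \<Rightarrow> int \<Rightarrow> bool" where
  "gmc_yes_instance G l T k \<longleftrightarrow> gmc_instance G l T \<and>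
     (\<exists>S \<subseteq> verts G. int (card S) \<le> k \<and>
       (\<forall>i\<in>{1..l}. \<forall>j\<in>{1..l}. i \<noteq> j \<longrightarrow>
         (\<forall>u\<in>T i. \<forall>v\<in>T j. \<not> (\<exists>w. pre_digraph.apath (delete_verts G S) u w v))))"

end

theory Submission
  imports Defs
begin

text \<open>
  Two vertices are equal or adjacent in \<open>G\<^sup>2\<close> iff their closed neighbourhoods in \<open>G\<close> meet. Since
  a happy vertex shares its color with its whole closed neighbourhood, the color is constant along
  paths of \<open>G\<^sup>2\<close> through happy vertices, so the potentially happy vertices that a coloring leaves
  unhappy form a cut. Conversely, after removing a cut, every remaining component meets at most one
  terminal set; giving the closed neighbourhoods of its vertices the color of that set is
  consistent, extends \<open>p\<close>, and makes all remaining vertices happy.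
\<close>

lemma mem_closed_nbhd_iff: "u \<in> closed_nbhd G v \<longleftrightarrow> u = v \<or> v \<rightarrow>\<^bsub>G\<^esub> u"
  by (auto simp: closed_nbhd_def)

lemma happy_iff_closed_nbhd: "happy G c v \<longleftrightarrow> (\<forall>u\<in>closed_nbhd G v. c u = c v)"
  by (metis happy_def mem_closed_nbhd_iff)

lemma dominates_induce_subgraph_iff:
  "u \<rightarrow>\<^bsub>G \<restriction> A\<^esub> v \<longleftrightarrow> u \<in> A \<and> v \<in> A \<and> u \<rightarrow>\<^bsub>G\<^esub> v"
  by (auto simp: arcs_ends_conv)

text \<open>With unit costs the cost of a walk is its number of arcs, and the three disjuncts are
  the walks with 0, 1 and 2 arcs.\<close>

lemma (in wf_digraph) graph_dist_le_2_iff: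
  assumes "u \<in> verts G"
  shows "graph_dist G u v \<le> 2 \<longleftrightarrow> u = v \<or> u \<rightarrow> v \<or> (\<exists>w. u \<rightarrow> w \<and> w \<rightarrow> v)"
proof
  assume "graph_dist G u v \<le> 2"
  \<comment> \<open>The distance is an infimum, and only a strict upper bound on it yields a walk
    directly. Relaxing to 3 loses nothing because lengths are integers.\<close>
  also have "(2::ereal) < 3" by simp
  finally obtain q where q: "awalk u q v" "ereal (awalk_cost (\<lambda>_. 1) q) < 3"
    by (auto simp: graph_dist_def \<mu>_def INF_less_iff)
  have "awalk_cost (\<lambda>_. 1) q = real (length q)"
    by (induction q) auto
  with q(2) have "length q < 3" by simp
  then consider "q = []" | a where "q = [a]" | a b where "q = [a, b]"
    by (auto simp: less_Suc_eq length_Suc_conv numeral_3_eq_3)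
  then show "u = v \<or> u \<rightarrow> v \<or> (\<exists>w. u \<rightarrow> w \<and> w \<rightarrow> v)"
    using q(1) by cases (auto simp: awalk_def arcs_ends_conv)
next
  have *: "graph_dist G u v \<le> 2" if "awalk u q v" "awalk_cost (\<lambda>_. 1) q \<le> 2" for q
  proof -
    have "graph_dist G u v \<le> ereal (awalk_cost (\<lambda>_. 1) q)"
      unfolding graph_dist_def by (rule min_cost_le_walk_cost[OF that(1)])
    also have "\<dots> \<le> 2" using that(2) by simp
    finally show ?thesis .
  qed
  assume "u = v \<or> u \<rightarrow> v \<or> (\<exists>w. u \<rightarrow> w \<and> w \<rightarrow> v)"
  then consider "u = v" | "u \<rightarrow> v" | w where "u \<rightarrow> w" "w \<rightarrow> v" by blast
  then show "graph_dist G u v \<le> 2"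
  proof cases
    case 1
    then show ?thesis using assms by (intro *[of "[]"]) (auto simp: awalk_def)
  next
    case 2
    then obtain a where "a \<in> arcs G" "tail G a = u" "head G a = v" by auto
    then show ?thesis using assms by (intro *[of "[a]"]) (auto simp: awalk_def)
  next
    case 3
    then obtain a b where "a \<in> arcs G" "tail G a = u" "head G a = w"
      "b \<in> arcs G" "tail G b = w" "head G b = v" by (metis reachableE)
    then show ?thesis using assms by (intro *[of "[a, b]"]) (auto simp: awalk_def)
  qed
qed

lemma verts_square [simp]: "verts (square G) = verts G"
  by (simp add: square_def)

text \<open>A common element of the closed neighbourhoods is either one of \<open>u\<close> and
  \<open>v\<close>, which are then adjacent, or the midpoint of a walk with two arcs, whose second
  arc is reversed by symmetry.\<close>

lemma (in sym_digraph) square_dominates_iff: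
  "u \<rightarrow>\<^bsub>square G\<^esub> v \<longleftrightarrow> u \<noteq> v \<and> closed_nbhd G u \<inter> closed_nbhd G v \<noteq> {}"
proof -
  have sym: "a \<rightarrow> b \<longleftrightarrow> b \<rightarrow> a" for a b
    using arcs_ends_symmetric[OF sym_arcs] by blast
  have "u \<rightarrow>\<^bsub>square G\<^esub> v \<longleftrightarrow>
      u \<in> verts G \<and> v \<in> verts G \<and> u \<noteq> v \<and> (u \<rightarrow> v \<or> (\<exists>w. u \<rightarrow> w \<and> w \<rightarrow> v))"
    by (auto simp: square_def graph_dist_le_2_iff[simplified])
  also have "\<dots> \<longleftrightarrow> u \<noteq> v \<and> closed_nbhd G u \<inter> closed_nbhd G v \<noteq> {}"
    using sym by (auto simp: closed_nbhd_def dest: adj_in_verts)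
  finally show ?thesis .
qed

lemma (in graph) graph_square: "graph (square G)"
proof -
  have "symmetric (square G)"
    by (auto simp: symmetric_def sym_def square_dominates_iff)
  moreover have "arcs (square G) \<subseteq> verts G \<times> verts G"
    by (auto simp: square_def)
  then have "finite (arcs (square G))"
    by (rule finite_subset) simp
  ultimately show ?thesis
    by unfold_locales (auto simp: square_def arc_to_ends_def)
qed

lemma (in graph) graph_induce_subgraph:
  assumes "A \<subseteq> verts G"
  shows "graph (G \<restriction> A)"
  using digraphI_induced[OF induced_induce[OF assms]]
    induced_graph_imp_symmetric[OF sym_arcs induced_induce[OF assms]]
  by (rule digraph.graphI)

lemma potentially_happy_subset: "potentially_happy G l p \<subseteq> verts G"
  by (auto simp: potentially_happy_def)

lemma potentially_happy_in_subset: "potentially_happy_in G l p i \<subseteq> potentially_happy G l p"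
  by (auto simp: potentially_happy_in_def)

text \<open>Happiness transfers the color of a precolored vertex in the closed neighbourhood to
  \<open>v\<close>.\<close>

lemma happy_potentially_happy_in_color:
  assumes "c \<in> extending_colorings G l p" "happy G c v" "v \<in> potentially_happy_in G l p i"
  shows "c v = i"
proof -
  obtain u where u: "u \<in> closed_nbhd G v" "p u = Some i"
    using assms(3) by (auto simp: potentially_happy_in_def)
  from u(2) assms(1) have "c u = i" by (force simp: extending_colorings_def)
  with assms(2) u(1) show ?thesis by (metis happy_iff_closed_nbhd)
qed

text \<open>Any extending coloring that makes \<open>v\<close> happy determines the index as the
  color of \<open>v\<close>.\<close>

lemma disjoint_potentially_happy_in: "disjoint_family_on (potentially_happy_in G l p) I"
proof -
  have "i = j" if v: "v \<in> potentially_happy_in G l p i" "v \<in> potentially_happy_in G l p j" for v i j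
  proof -
    obtain c where "c \<in> extending_colorings G l p" "happy G c v"
      using v(1) by (auto simp: potentially_happy_in_def potentially_happy_def)
    with v show ?thesis by (metis happy_potentially_happy_in_color)
  qed
  then show ?thesis unfolding disjoint_family_on_def by blast
qed

lemma (in graph) gmc_instance_square:
  "gmc_instance (square G \<restriction> potentially_happy G l p) l (potentially_happy_in G l p)"
  by (simp add: gmc_instance_def graph.graph_induce_subgraph graph_square potentially_happy_subset
      potentially_happy_in_subset disjoint_potentially_happy_in)

text \<open>The ends of each arc of the square have a common closed neighbour, and happiness makes
  both agree with it in color.\<close>

lemma (in sym_digraph) happy_reachable_square_same_color:
  assumes "u \<rightarrow>\<^sup>*\<^bsub>square G \<restriction> A\<^esub> v" "wf_digraph (square G \<restriction> A)"
    and "\<And>x. x \<in> A \<Longrightarrow> happy G c x"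
  shows "c u = c v"
proof -
  interpret D: wf_digraph "square G \<restriction> A" by (rule assms(2))
  show ?thesis
    using assms(1)
  proof (induction rule: D.reachable_induct)
    case (step x y)
    then obtain z where "x \<in> A" "y \<in> A" "z \<in> closed_nbhd G x" "z \<in> closed_nbhd G y"
      by (auto simp: dominates_induce_subgraph_iff square_dominates_iff)
    then have "c x = c y" using assms(3) by (metis happy_iff_closed_nbhd)
    with step.IH show ?case by simp
  qed simp
qed

text \<open>This yields the coloring for the direction from cuts to happy vertices, with
  \<open>A\<close> the vertices that survive the cut. A color is chosen for each component of the
  square on \<open>A\<close> and then spread to closed neighbourhoods.\<close>

lemma (in graph) separated_extending_coloring:
  assumes l: "l \<ge> 1" and p: "partial_coloring G l p" and A: "A \<subseteq> verts G"
    and near: "\<And>i u. u \<in> A \<Longrightarrow> closed_nbhd G u \<inter> {x. p x = Some i} \<noteq> {} \<Longrightarrow> u \<in> T i"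
    and sep: "\<And>i j u v. \<lbrakk>i \<in> {1..l}; j \<in> {1..l}; u \<in> T i; v \<in> T j; u \<rightarrow>\<^sup>*\<^bsub>square G \<restriction> A\<^esub> v\<rbrakk> \<Longrightarrow> i = j"
  shows "\<exists>c \<in> extending_colorings G l p. \<forall>v\<in>A. happy G c v"
proof -
  interpret D: graph "square G \<restriction> A"
    using graph.graph_induce_subgraph[OF graph_square] A by simp
  \<comment> \<open>\<open>hits v i\<close> says that the component of \<open>v\<close> contains a
    terminal of \<open>T i\<close>.\<close>
  define hits where "hits v i \<longleftrightarrow> i \<in> {1..l} \<and> (\<exists>t\<in>T i. v \<rightarrow>\<^sup>*\<^bsub>square G \<restriction> A\<^esub> t)" for v i
  \<comment> \<open>A component without terminals may take any color; 1 is legal since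
    \<open>l \<ge> 1\<close>.\<close>
  define col where "col v = (if \<exists>i. hits v i then SOME i. hits v i else 1)" for v
  \<comment> \<open>Equality as predicates makes \<open>SOME\<close> in \<open>col\<close> return
    the same color throughout a component.\<close>
  have hits_cong: "hits u = hits v" if "u \<rightarrow>\<^sup>*\<^bsub>square G \<restriction> A\<^esub> v" for u v
    using that D.symmetric_reachable'[OF that] unfolding hits_def
    by (blast intro: D.reachable_trans)
  have hits_unique: "i = j" if "hits v i" "hits v j" for v i j
  proof -
    from that obtain s t where "i \<in> {1..l}" "s \<in> T i" "v \<rightarrow>\<^sup>*\<^bsub>square G \<restriction> A\<^esub> s"
      "j \<in> {1..l}" "t \<in> T j" "v \<rightarrow>\<^sup>*\<^bsub>square G \<restriction> A\<^esub> t" by (auto simp: hits_def)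
    then show ?thesis
      using sep D.reachable_trans[OF D.symmetric_reachable'] by blast
  qed
  have col_range: "col v \<in> {1..l}" for v
  proof (cases "\<exists>i. hits v i")
    case True
    then have "hits v (col v)" unfolding col_def by (simp add: someI_ex)
    then show ?thesis by (simp add: hits_def)
  qed (use l in \<open>simp add: col_def\<close>)
  have col_near: "col u = col v"
    if "u \<in> A" "v \<in> A" "x \<in> closed_nbhd G u" "x \<in> closed_nbhd G v" for u v x
  proof (cases "u = v")
    case False
    then have "u \<rightarrow>\<^sup>*\<^bsub>square G \<restriction> A\<^esub> v"
      using that by (intro D.reachable_adjI) (auto simp: dominates_induce_subgraph_iff square_dominates_iff)
    then have "hits u = hits v" by (rule hits_cong)
    then show ?thesis by (simp add: col_def)
  qed simp
  have col_pre: "col v = i" if "v \<in> A" "x \<in> closed_nbhd G v" "p x = Some i" for v x i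
  proof -
    \<comment> \<open>By \<open>near\<close>, \<open>v\<close> is itself a terminal, so its
      component hits \<open>i\<close> through the trivial walk.\<close>
    have "v \<in> T i" using that by (intro near) auto
    moreover have "i \<in> {1..l}" using p that(3) by (auto simp: partial_coloring_def ran_def)
    ultimately have "hits v i" using that(1) by (auto simp: hits_def intro!: bexI[of _ v])
    then have "hits v (col v)" unfolding col_def by (metis someI)
    then show ?thesis using \<open>hits v i\<close> by (rule hits_unique)
  qed
  \<comment> \<open>Consulting \<open>p\<close> first makes \<open>c\<close> extend \<open>p\<close>
    outright. Which \<open>v\<close> is picked by \<open>SOME\<close> is irrelevant by
    \<open>col_near\<close>, and vertices away from \<open>A\<close> get the default 1.\<close>
  define c where "c x = (case p x of Some i \<Rightarrow> i | None \<Rightarrow>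
    if \<exists>v\<in>A. x \<in> closed_nbhd G v then col (SOME v. v \<in> A \<and> x \<in> closed_nbhd G v) else 1)" for x
  have c_near: "c x = col v" if v: "v \<in> A" "x \<in> closed_nbhd G v" for v x
  proof (cases "p x")
    case None
    have "(SOME v. v \<in> A \<and> x \<in> closed_nbhd G v) \<in> A \<and>
        x \<in> closed_nbhd G (SOME v. v \<in> A \<and> x \<in> closed_nbhd G v)"
      using v by (intro someI[of "\<lambda>v. v \<in> A \<and> x \<in> closed_nbhd G v"]) auto
    with None v show ?thesis by (auto simp: c_def intro: col_near)
  next
    case (Some i)
    with col_pre[OF v] show ?thesis by (simp add: c_def)
  qed
  have "c x \<in> {1..l}" for x
    using p l col_range by (auto simp: c_def partial_coloring_def ran_def split: option.split)
  then have "c \<in> extending_colorings G l p"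
    by (auto simp: extending_colorings_def c_def)
  \<comment> \<open>Since \<open>v\<close> lies in its own closed neighbourhood, \<open>c\<close>
    equals \<open>col v\<close> at \<open>v\<close> and at all its neighbours.\<close>
  moreover have "happy G c v" if "v \<in> A" for v
    using c_near that by (metis happy_iff_closed_nbhd mem_closed_nbhd_iff)
  ultimately show ?thesis by blast
qed

theorem theorem6:
  fixes G :: "('a, 'b) pre_digraph" and l :: nat and p :: "'a \<Rightarrow> nat option" and k :: int
  assumes "l \<ge> 1"
    and "mhv_instance G l p"
  shows "mhv_yes_instance G l p k \<longleftrightarrow>
    gmc_yes_instance (square G \<restriction> potentially_happy G l p) l (potentially_happy_in G l p)
      (int (card (potentially_happy G l p)) - k)"
proof -
  interpret graph G using assms(2) by (simp add: mhv_instance_def)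
  have p: "partial_coloring G l p" using assms(2) by (simp add: mhv_instance_def)
  define H where "H = potentially_happy G l p"
  define T where "T = potentially_happy_in G l p"
  have H: "H \<subseteq> verts G" unfolding H_def by (rule potentially_happy_subset)
  then have fin: "finite H" by (rule finite_subset) simp
  have del: "delete_verts (square G \<restriction> H) S = square G \<restriction> (H - S)" for S
    by (auto simp: delete_verts_def induce_subgraph_def)
  have graph_del: "graph (square G \<restriction> (H - S))" for S
    using H by (intro graph.graph_induce_subgraph[OF graph_square]) auto
  \<comment> \<open>Every walk shortens to a path, so the cut condition can be stated by
    reachability, which composes more easily.\<close>
  have path_iff: "(\<exists>w. pre_digraph.apath (delete_verts (square G \<restriction> H) S) u w v) \<longleftrightarrow>
      u \<rightarrow>\<^sup>*\<^bsub>square G \<restriction> (H - S)\<^esub> v" for S u v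
  proof -
    interpret D: graph "square G \<restriction> (H - S)" by (rule graph_del)
    show ?thesis by (simp add: del D.reachable_apath)
  qed
  have gmc_iff: "gmc_yes_instance (square G \<restriction> H) l T k' \<longleftrightarrow>
    (\<exists>S \<subseteq> H. int (card S) \<le> k' \<and> (\<forall>i\<in>{1..l}. \<forall>j\<in>{1..l}. i \<noteq> j \<longrightarrow>
       (\<forall>u\<in>T i. \<forall>v\<in>T j. \<not> u \<rightarrow>\<^sup>*\<^bsub>square G \<restriction> (H - S)\<^esub> v)))" for k'
    using gmc_instance_square[of l p]
    by (simp add: gmc_yes_instance_def path_iff H_def[symmetric] T_def)
  have "mhv_yes_instance G l p k \<longleftrightarrow> gmc_yes_instance (square G \<restriction> H) l T (int (card H) - k)"
  proof
    assume "mhv_yes_instance G l p k"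
    then obtain c where c: "c \<in> extending_colorings G l p"
      and k: "int (card {v \<in> verts G. happy G c v}) \<ge> k"
      by (auto simp: mhv_yes_instance_def)
    \<comment> \<open>The cut is \<open>H - A\<close>: as \<open>c\<close> witnesses that
      \<open>A\<close> lies in \<open>H\<close>, exactly the happy vertices remain.\<close>
    define A where "A = {v \<in> verts G. happy G c v}"
    have "A \<subseteq> H" using c by (auto simp: A_def H_def potentially_happy_def)
    then have rest: "H - (H - A) = A" by blast
    \<comment> \<open>The second fact keeps the subtraction of naturals from truncating when it is
      moved to the integers.\<close>
    have "card (H - A) = card H - card A" "card A \<le> card H"
      using \<open>A \<subseteq> H\<close> fin by (auto intro: card_Diff_subset card_mono finite_subset)
    then have "int (card (H - A)) \<le> int (card H) - k" using k by (simp add: A_def)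
    moreover have "i = j"
      if uv: "u \<in> T i" "v \<in> T j" and reach: "u \<rightarrow>\<^sup>*\<^bsub>square G \<restriction> A\<^esub> v" for i j u v
    proof -
      interpret D: graph "square G \<restriction> A" using graph_del[of "H - A"] by (simp add: rest)
      have "c u = c v"
        using reach D.wf_digraph by (rule happy_reachable_square_same_color) (simp add: A_def)
      moreover have "happy G c u" "happy G c v"
        using D.reachable_in_verts[OF reach] by (auto simp: A_def)
      ultimately show ?thesis
        using uv c by (metis T_def happy_potentially_happy_in_color)
    qed
    ultimately show "gmc_yes_instance (square G \<restriction> H) l T (int (card H) - k)"
      unfolding gmc_iff by (intro exI[of _ "H - A"]) (auto simp: rest)
  next
    assume "gmc_yes_instance (square G \<restriction> H) l T (int (card H) - k)"
    then obtain S where S: "S \<subseteq> H" "int (card S) \<le> int (card H) - k"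
      and sep: "\<And>i j u v. \<lbrakk>i \<in> {1..l}; j \<in> {1..l}; u \<in> T i; v \<in> T j;
        u \<rightarrow>\<^sup>*\<^bsub>square G \<restriction> (H - S)\<^esub> v\<rbrakk> \<Longrightarrow> i = j"
      unfolding gmc_iff by blast
    have "\<exists>c \<in> extending_colorings G l p. \<forall>v\<in>H - S. happy G c v"
    proof (rule separated_extending_coloring[OF assms(1) p _ _ sep])
      \<comment> \<open>Vertices of \<open>H - S\<close> are potentially happy, so a precolored
        vertex nearby is all that membership in \<open>T i\<close> still requires.\<close>
      show "u \<in> T i" if "u \<in> H - S" "closed_nbhd G u \<inter> {x. p x = Some i} \<noteq> {}" for i u
        using that by (simp add: T_def H_def potentially_happy_in_def)
    qed (use H in auto)
    then obtain c where c: "c \<in> extending_colorings G l p" "\<forall>v\<in>H - S. happy G c v" by blast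
    have "card (H - S) \<le> card {v \<in> verts G. happy G c v}"
      using c(2) H by (intro card_mono) auto
    moreover have "card (H - S) = card H - card S" "card S \<le> card H"
      using S(1) fin by (auto intro: card_Diff_subset card_mono finite_subset)
    ultimately show "mhv_yes_instance G l p k"
      using S(2) c(1) assms(2) by (auto simp: mhv_yes_instance_def intro!: bexI[of _ c])
  qed
  then show ?thesis by (simp add: H_def T_def)
qed

end
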